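(* Let $a,b,c,d\in\mathbb{C}$ be four pairwise distinct points and consider the four points $$p_{ab}=f(d,a,b,c),\quad p_{bc}=f(a,b,c,d),\quad p_{cd}=f(b,c,d,a),\quad p_{da}=f(c,d,a,b).$$ Then $p_{ab},p_{bc},p_{cd},p_{da}$ are concyclic with $\mathrm{cr}(p_{ab},p_{bc},p_{cd},p_{da})=-1$.
   Context: The cross-ratio is $\mathrm{cr}(a,b,c,d)=\frac{(a-b)(c-d)}{(b-c)(d-a)}$, extended to one argument equal to $\infty$ by taking limits. For pairwise distinct $a,b,c,d\in\mathbb{C}$, $$f(a,b,c,d)=\frac{c(b-a)\sqrt{\mathrm{cr}(c,a,b,d)}+b(c-a)}{(b-a)\sqrt{\mathrm{cr}(c,a,b,d)}+(c-a)}\in\mathbb{C}\cup\{\infty\},$$ where $\sqrt{\cdot}$ is the principal square root and the value is $\infty$ if the denominator vanishes. Concyclic means lying on a common circle, where a straight line together with $\infty$ counts as a circle. *)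

theory Defs
  imports "HOL-Analysis.Analysis"
begin

text \<open>
  The extended plane is \<^typ>\<open>complex option\<close>, with \<^const>\<open>None\<close> for \<open>\<infinity>\<close>, the carrier that
  \<^const>\<open>Alexandroff_compactification\<close> uses for the one-point compactification of \<^typ>\<open>complex\<close>.
\<close>

type_synonym ext_complex = "complex option"

abbreviation infty :: ext_complex where
  "infty \<equiv> None"

definition cross_ratio :: "complex \<Rightarrow> complex \<Rightarrow> complex \<Rightarrow> complex \<Rightarrow> complex" where
  "cross_ratio a b c d = ((a - b) * (c - d)) / ((b - c) * (d - a))"

text \<open>
  At most one argument may be \<open>\<infinity>\<close>; with two or more infinite arguments the value is
  unspecified.
\<close>

fun ext_cross_ratio :: "ext_complex \<Rightarrow> ext_complex \<Rightarrow> ext_complex \<Rightarrow> ext_complex \<Rightarrow> complex" where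
  "ext_cross_ratio (Some a) (Some b) (Some c) (Some d) = cross_ratio a b c d"
| "ext_cross_ratio None (Some b) (Some c) (Some d) = Lim at_infinity (\<lambda>z. cross_ratio z b c d)"
| "ext_cross_ratio (Some a) None (Some c) (Some d) = Lim at_infinity (\<lambda>z. cross_ratio a z c d)"
| "ext_cross_ratio (Some a) (Some b) None (Some d) = Lim at_infinity (\<lambda>z. cross_ratio a b z d)"
| "ext_cross_ratio (Some a) (Some b) (Some c) None = Lim at_infinity (\<lambda>z. cross_ratio a b c z)"
| "ext_cross_ratio _ _ _ _ = undefined"

text \<open>The limits in \<^const>\<open>ext_cross_ratio\<close> exist, with the expected values.\<close>

lemma tendsto_linear_quotient_at_infinity:
  fixes p q :: complex
  shows "((\<lambda>z. (z - p) / (q - z)) \<longlongrightarrow> - 1) at_infinity"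
proof -
  have "filterlim (\<lambda>z. - z + q) at_infinity at_infinity"
    by (rule tendsto_add_filterlim_at_infinity'[OF _ tendsto_const])
       (simp add: filterlim_at_infinity_conv_norm_at_top filterlim_norm_at_top)
  then have "((\<lambda>z. (q - p) / (q - z)) \<longlongrightarrow> 0) at_infinity"
    by (intro tendsto_divide_0[OF tendsto_const]) simp
  then have "((\<lambda>z. (q - p) / (q - z) - 1) \<longlongrightarrow> 0 - 1) at_infinity"
    by (intro tendsto_diff tendsto_const)
  moreover have "eventually (\<lambda>z. z \<noteq> q) at_infinity"
    by (auto simp: eventually_at_infinity intro!: exI[of _ "norm q + 1"])
  then have "eventually (\<lambda>z. (q - p) / (q - z) - 1 = (z - p) / (q - z)) at_infinity"
    by eventually_elim (simp add: divide_simps)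
  ultimately show ?thesis
    by (simp add: filterlim_cong)
qed

lemma tendsto_cross_ratio_at_infinity:
  "((\<lambda>z. cross_ratio z b c d) \<longlongrightarrow> - ((c - d) / (b - c))) at_infinity"
  "((\<lambda>z. cross_ratio a z c d) \<longlongrightarrow> - ((c - d) / (d - a))) at_infinity"
  "((\<lambda>z. cross_ratio a b z d) \<longlongrightarrow> - ((a - b) / (d - a))) at_infinity"
  "((\<lambda>z. cross_ratio a b c z) \<longlongrightarrow> - ((a - b) / (b - c))) at_infinity"
proof -
  have flip: "(p - z) / (z - q) = (z - p) / (q - z)" for p q z :: complex
    using minus_divide_divide[of "p - z" "z - q"] by simp
  have "cross_ratio z b c d = (c - d) / (b - c) * ((z - b) / (d - z))" for z
    by (simp add: cross_ratio_def mult.commute)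
  then show "((\<lambda>z. cross_ratio z b c d) \<longlongrightarrow> - ((c - d) / (b - c))) at_infinity"
    using tendsto_mult_left[OF tendsto_linear_quotient_at_infinity, of "(c - d) / (b - c)" b d] by simp
  have "cross_ratio a z c d = (c - d) / (d - a) * ((a - z) / (z - c))" for z
    by (simp add: cross_ratio_def mult.commute)
  then show "((\<lambda>z. cross_ratio a z c d) \<longlongrightarrow> - ((c - d) / (d - a))) at_infinity"
    using tendsto_mult_left[OF tendsto_linear_quotient_at_infinity, of "(c - d) / (d - a)" a c]
    by (simp only: flip) simp
  have "cross_ratio a b z d = (a - b) / (d - a) * ((z - d) / (b - z))" for z
    by (simp add: cross_ratio_def mult.commute)
  then show "((\<lambda>z. cross_ratio a b z d) \<longlongrightarrow> - ((a - b) / (d - a))) at_infinity"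
    using tendsto_mult_left[OF tendsto_linear_quotient_at_infinity, of "(a - b) / (d - a)" d b] by simp
  have "cross_ratio a b c z = (a - b) / (b - c) * ((c - z) / (z - a))" for z
    by (simp add: cross_ratio_def mult.commute)
  then show "((\<lambda>z. cross_ratio a b c z) \<longlongrightarrow> - ((a - b) / (b - c))) at_infinity"
    using tendsto_mult_left[OF tendsto_linear_quotient_at_infinity, of "(a - b) / (b - c)" c a]
    by (simp only: flip) simp
qed

lemma ext_cross_ratio_infty:
  "ext_cross_ratio infty (Some b) (Some c) (Some d) = - ((c - d) / (b - c))"
  "ext_cross_ratio (Some a) infty (Some c) (Some d) = - ((c - d) / (d - a))"
  "ext_cross_ratio (Some a) (Some b) infty (Some d) = - ((a - b) / (d - a))"
  "ext_cross_ratio (Some a) (Some b) (Some c) infty = - ((a - b) / (b - c))"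
  using tendsto_cross_ratio_at_infinity by (simp_all add: tendsto_Lim[OF trivial_limit_at_infinity])

definition f :: "complex \<Rightarrow> complex \<Rightarrow> complex \<Rightarrow> complex \<Rightarrow> ext_complex" where
  "f a b c d =
    (let s = csqrt (cross_ratio c a b d);
         num = c * (b - a) * s + b * (c - a);
         den = (b - a) * s + (c - a)
     in if den = 0 then infty else Some (num / den))"

definition generalized_circle :: "ext_complex set \<Rightarrow> bool" where
  "generalized_circle C \<longleftrightarrow>
    (\<exists>z r. r > 0 \<and> C = Some ` sphere z r) \<or>
    (\<exists>u v. u \<noteq> v \<and> C = insert infty (Some ` (affine hull {u, v})))"

definition concyclic :: "ext_complex set \<Rightarrow> bool" where
  "concyclic S \<longleftrightarrow> (\<exists>C. generalized_circle C \<and> S \<subseteq> C)"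

end

theory Submission
  imports Defs
begin

text \<open>
  For distinct \<open>a, b, c, d\<close> there is a unique Moebius involution that swaps \<open>a\<close> with \<open>d\<close> and
  \<open>b\<close> with \<open>c\<close>. In the coordinate \<open>w = (z - b) / (z - c)\<close> it reads \<open>w \<mapsto> w(a) w(d) / w\<close>, so its
  two fixed points are the two solutions of \<open>w\<^sup>2 = w(a) w(d)\<close>. The formula for \<open>f a b c d\<close> is one of
  these solutions, written with a choice of square root; \<open>f c d a b\<close> uses the same square root \<open>s\<close>,
  is a fixed point of the same involution, and would coincide with the first only if \<open>s\<close> were \<open>0\<close> or
  \<open>-1\<close>. Distinctness of the points excludes \<open>0\<close>, and the principal branch, having nonnegative
  real part, excludes \<open>-1\<close>. Hence \<open>{p_bc, p_da}\<close> is the full fixed-point set of that involution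
  (\<open>f_pair_fixed_points\<close>), and \<open>{p_ab, p_cd}\<close> is that of the involution that swaps \<open>a\<close> with \<open>b\<close> and
  \<open>c\<close> with \<open>d\<close>.

  The two involutions commute, and fixed-point pairs of distinct commuting involutions separate
  each other harmonically, which is the claim about the cross-ratio. In coefficients, the quadratic
  forms that vanish at the two pairs are apolar, and apolarity of two pairs expands to the
  vanishing of the numerator of cross-ratio plus one.

  All of this is done in homogeneous coordinates, so that the point at infinity needs no
  attention until the cross-ratio itself is evaluated (\<open>ext_cross_ratio_harmonic\<close>).
  Concyclicity is then a consequence of harmonicity (\<open>concyclic_if_harmonic\<close>): an affine change
  of coordinate brings four finite harmonic points to \<open>1, w, -1, 1/w\<close>, through which a circle
  or line can be written down, and if one point is \<open>\<infinity>\<close> then the opposite one is the midpoint of the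
  other two.
\<close>

section \<open>Homogeneous coordinates and the cross-ratio\<close>

definition of_homogeneous :: "complex \<Rightarrow> complex \<Rightarrow> ext_complex" where
  "of_homogeneous N D = (if D = 0 then infty else Some (N / D))"

lemma of_homogeneous_distinct:
  assumes "M * E - N * D \<noteq> 0"
  shows "of_homogeneous M D \<noteq> of_homogeneous N E"
  using assms by (auto simp: of_homogeneous_def frac_eq_eq split: if_splits)

text \<open>
  The denominators cancel from a cross-ratio of four points in homogeneous coordinates, because every
  point occurs once above and once below; this remains so in the limit where one denominator
  is \<open>0\<close>. The pairwise nonvanishing determinants ensure that at most one denominator is \<open>0\<close>.
\<close>

lemma ext_cross_ratio_harmonic:
  fixes N1 N2 N3 N4 D1 D2 D3 D4 :: complex
  assumes harmonic: "(N1 * D2 - N2 * D1) * (N3 * D4 - N4 * D3)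
                      = - ((N2 * D3 - N3 * D2) * (N4 * D1 - N1 * D4))"
    and nz: "N1 * D2 - N2 * D1 \<noteq> 0" "N2 * D3 - N3 * D2 \<noteq> 0"
      "N3 * D4 - N4 * D3 \<noteq> 0" "N4 * D1 - N1 * D4 \<noteq> 0"
      "N1 * D3 - N3 * D1 \<noteq> 0" "N2 * D4 - N4 * D2 \<noteq> 0"
  shows "ext_cross_ratio (of_homogeneous N1 D1) (of_homogeneous N2 D2) (of_homogeneous N3 D3) (of_homogeneous N4 D4) = - 1"
proof -
  have diff: "N / D - M / E = (N * E - M * D) / (D * E)" if "D \<noteq> 0" "E \<noteq> 0" for N D M E :: complex
    using that by (simp add: field_simps)
  consider "D1 = 0" "D2 \<noteq> 0" "D3 \<noteq> 0" "D4 \<noteq> 0" | "D1 \<noteq> 0" "D2 = 0" "D3 \<noteq> 0" "D4 \<noteq> 0"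
    | "D1 \<noteq> 0" "D2 \<noteq> 0" "D3 = 0" "D4 \<noteq> 0" | "D1 \<noteq> 0" "D2 \<noteq> 0" "D3 \<noteq> 0" "D4 = 0"
    | "D1 \<noteq> 0" "D2 \<noteq> 0" "D3 \<noteq> 0" "D4 \<noteq> 0"
    using nz by fastforce
  then show ?thesis
  proof cases
    case 1
    then show ?thesis using nz harmonic
      by (simp add: of_homogeneous_def ext_cross_ratio_infty diff mult_ac del: ext_cross_ratio.simps)
  next
    case 2
    then show ?thesis using nz harmonic
      by (simp add: of_homogeneous_def ext_cross_ratio_infty diff mult_ac del: ext_cross_ratio.simps)
  next
    case 3
    then show ?thesis using nz harmonic
      by (simp add: of_homogeneous_def ext_cross_ratio_infty diff mult_ac del: ext_cross_ratio.simps)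
  next
    case 4
    then show ?thesis using nz harmonic
      by (simp add: of_homogeneous_def ext_cross_ratio_infty diff mult_ac del: ext_cross_ratio.simps)
  next
    case 5
    then show ?thesis using nz harmonic
      by (simp add: of_homogeneous_def cross_ratio_def diff)
  qed
qed

section \<open>Harmonic quadruples are concyclic\<close>

lemma concyclic_infty_midpoint:
  fixes u v :: complex
  assumes "u \<noteq> v"
  shows "concyclic {infty, Some u, Some ((u + v) / 2), Some v}"
proof -
  have "(u + v) / 2 = (1/2) *\<^sub>R u + (1/2) *\<^sub>R v"
    by (simp add: scaleR_conv_of_real field_simps)
  then have "(u + v) / 2 \<in> affine hull {u, v}"
    unfolding affine_hull_2 by force
  moreover have "u \<in> affine hull {u, v}" "v \<in> affine hull {u, v}"
    by (simp_all add: hull_inc)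
  ultimately show ?thesis
    using assms unfolding concyclic_def generalized_circle_def
    by (intro exI[of _ "insert infty (Some ` (affine hull {u, v}))"]) auto
qed

text \<open>
  Up to the similarity \<open>z \<mapsto> m + k z\<close> the points are \<open>1, w, -1, 1/w\<close>. A circle through \<open>1\<close> and \<open>-1\<close>
  has a centre \<open>\<i> t\<close> with \<open>t\<close> real and the equation \<open>\<bar>z\<bar>\<^sup>2 - 1 = 2 t Im z\<close>. This equation is invariant under
  \<open>z \<mapsto> 1/z\<close>, which divides both sides by \<open>- \<bar>z\<bar>\<^sup>2\<close>, so it only remains to choose \<open>t\<close> to fit \<open>w\<close>.
  For real \<open>w\<close> the circle degenerates to the real line.
\<close>

lemma concyclic_harmonic_normal_form:
  fixes m k w :: complex
  assumes "k \<noteq> 0" "w \<noteq> 0"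
  shows "concyclic {Some (m + k), Some (m + k * w), Some (m - k), Some (m + k / w)}"
proof (cases "Im w = 0")
  case True
  have on_line: "m + k * of_real x \<in> affine hull {m + k, m - k}" for x
  proof -
    have "m + k * of_real x = ((1 + x) / 2) *\<^sub>R (m + k) + ((1 - x) / 2) *\<^sub>R (m - k)"
      by (simp add: scaleR_conv_of_real field_simps)
    moreover have "(1 + x) / 2 + (1 - x) / 2 = 1" by (simp add: field_simps)
    ultimately show ?thesis unfolding affine_hull_2 by blast
  qed
  have "w = of_real (Re w)"
    using True by (simp add: complex_eq_iff)
  then have "m + k * w \<in> affine hull {m + k, m - k}" "m + k / w \<in> affine hull {m + k, m - k}"
    using on_line[of "Re w"] on_line[of "1 / Re w"] by (simp_all add: divide_inverse)
  moreover have "m + k \<in> affine hull {m + k, m - k}" "m - k \<in> affine hull {m + k, m - k}"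
    by (simp_all add: hull_inc)
  moreover have neq: "m + k \<noteq> m - k"
  proof
    assume "m + k = m - k"
    then have "2 * k = 0" by (simp add: algebra_simps)
    then show False using assms by simp
  qed
  moreover have "generalized_circle (insert infty (Some ` (affine hull {m + k, m - k})))"
    using neq unfolding generalized_circle_def by blast
  ultimately show ?thesis
    unfolding concyclic_def
    by (intro exI[of _ "insert infty (Some ` (affine hull {m + k, m - k}))"]) auto
next
  case False
  define t where "t = ((cmod w)\<^sup>2 - 1) / (2 * Im w)"
  define r where "r = cmod k * sqrt (1 + t\<^sup>2)"
  have on_circle: "m + k * z \<in> sphere (m + k * (\<i> * of_real t)) r"
    if "(cmod z)\<^sup>2 - 1 = 2 * t * Im z" for z
  proof -
    have "(cmod (\<i> * of_real t - z))\<^sup>2 = 1 + t\<^sup>2"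
      using that unfolding cmod_power2 by (simp add: power2_eq_square algebra_simps)
    then have "cmod (\<i> * of_real t - z) = sqrt (1 + t\<^sup>2)"
      by (metis norm_ge_zero real_sqrt_unique)
    moreover have "dist (m + k * (\<i> * of_real t)) (m + k * z) = cmod k * cmod (\<i> * of_real t - z)"
      by (simp add: dist_norm flip: norm_mult right_diff_distrib)
    ultimately show ?thesis by (simp add: r_def)
  qed
  have w: "(cmod w)\<^sup>2 - 1 = 2 * t * Im w"
    using False by (simp add: t_def)
  have "(cmod (1 / w))\<^sup>2 - 1 = (1 - (cmod w)\<^sup>2) / (cmod w)\<^sup>2"
    using assms by (simp add: norm_divide power_divide diff_divide_distrib)
  also have "\<dots> = 2 * t * Im (1 / w)"
  proof -
    have "1 - (cmod w)\<^sup>2 = - (2 * t * Im w)"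
      using w by simp
    then show ?thesis
      by (simp add: Im_divide flip: cmod_power2)
  qed
  finally have "m + k * (1 / w) \<in> sphere (m + k * (\<i> * of_real t)) r"
    by (rule on_circle)
  moreover have "m + k * 1 \<in> sphere (m + k * (\<i> * of_real t)) r"
    by (rule on_circle) simp
  moreover have "m + k * (- 1) \<in> sphere (m + k * (\<i> * of_real t)) r"
    by (rule on_circle) simp
  moreover have "m + k * w \<in> sphere (m + k * (\<i> * of_real t)) r"
    by (rule on_circle) (rule w)
  moreover have "r > 0"
    using assms by (simp add: r_def add_pos_nonneg)
  ultimately show ?thesis
    unfolding concyclic_def generalized_circle_def
    by (intro exI[of _ "Some ` sphere (m + k * (\<i> * of_real t)) r"]) auto
qed

text \<open>
  With the midpoint \<open>m\<close> of \<open>x, z\<close> as origin, harmonicity becomes \<open>(y - m) (w - m) = k\<^sup>2\<close> where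
  \<open>x = m + k\<close> and \<open>z = m - k\<close>, which is the normal form above.
\<close>

lemma concyclic_harmonic_finite:
  fixes x y z w :: complex
  assumes "distinct [x, y, z, w]" and cr: "cross_ratio x y z w = - 1"
  shows "concyclic {Some x, Some y, Some z, Some w}"
proof -
  define m where "m = (x + z) / 2"
  define k where "k = (x - z) / 2"
  have "(x - y) * (z - w) = - ((y - z) * (w - x))"
    using assms by (simp add: cross_ratio_def divide_eq_eq split: if_splits)
  then have prod: "(y - m) * (w - m) = k * k"
    unfolding m_def k_def by (simp add: field_simps) algebra
  have "k \<noteq> 0" using assms by (simp add: k_def)
  moreover from this prod have "y - m \<noteq> 0" by auto
  ultimately have "concyclic {Some (m + k), Some (m + k * ((y - m) / k)), Some (m - k),
      Some (m + k / ((y - m) / k))}"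
    by (intro concyclic_harmonic_normal_form) auto
  moreover have "m + k = x" "m - k = z"
    by (simp_all add: m_def k_def field_simps)
  moreover have "m + k * ((y - m) / k) = y"
    using \<open>k \<noteq> 0\<close> by simp
  moreover have "m + k / ((y - m) / k) = w"
    using prod \<open>y - m \<noteq> 0\<close> by (simp add: field_simps)
  ultimately show ?thesis by simp
qed

lemma concyclic_if_harmonic:
  assumes dist: "distinct [x, y, z, w]" and cr: "ext_cross_ratio x y z w = - 1"
  shows "concyclic {x, y, z, w}"
proof -
  have mid: "concyclic {infty, Some u, Some v, Some v'}" if "u - v = v - v'" "u \<noteq> v'"
    for u v v' :: complex
  proof -
    have "v = (u + v') / 2" using that by (simp add: field_simps)
    then show ?thesis using concyclic_infty_midpoint[OF that(2)] by (simp only:)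
  qed
  consider
      x' y' z' w' where "x = Some x'" "y = Some y'" "z = Some z'" "w = Some w'"
    | y' z' w' where "x = infty" "y = Some y'" "z = Some z'" "w = Some w'"
    | x' z' w' where "x = Some x'" "y = infty" "z = Some z'" "w = Some w'"
    | x' y' w' where "x = Some x'" "y = Some y'" "z = infty" "w = Some w'"
    | x' y' z' where "x = Some x'" "y = Some y'" "z = Some z'" "w = infty"
    using dist by (cases x; cases y; cases z; cases w) auto
  then show ?thesis
  proof cases
    case 1
    then show ?thesis using assms by (auto intro: concyclic_harmonic_finite)
  next
    case 2
    then show ?thesis
      using assms mid[of y' z' w'] by (simp add: ext_cross_ratio_infty divide_eq_eq
          del: ext_cross_ratio.simps split: if_splits)
  next
    case 3
    then show ?thesis
      using assms mid[of z' w' x'] by (simp add: ext_cross_ratio_infty divide_eq_eq insert_commute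
          del: ext_cross_ratio.simps split: if_splits)
  next
    case 4
    then have "y' - x' = x' - w'" "y' \<noteq> w'"
      using assms
      by (auto simp: ext_cross_ratio_infty divide_eq_eq algebra_simps
          simp del: ext_cross_ratio.simps split: if_splits)
    from mid[OF this] show ?thesis
      using 4 by (simp add: insert_commute)
  next
    case 5
    then show ?thesis
      using assms mid[of x' y' z'] by (simp add: ext_cross_ratio_infty divide_eq_eq insert_commute
          del: ext_cross_ratio.simps split: if_splits)
  qed
qed

section \<open>The pairs of points as fixed points of involutions\<close>

text \<open>
  The involution swapping \<open>a, d\<close> and \<open>b, c\<close> relates \<open>z\<close> and \<open>z'\<close> by
  \<open>(a + d - b - c) z z' - (a d - b c) (z + z') + a d (b + c) - b c (a + d) = 0\<close>; setting \<open>z = z'\<close> gives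
  the quadratic for its fixed points. The last three conclusions are Vieta's formulas for this
  quadratic in homogeneous form, with \<open>k\<close> the scaling of the chosen coordinates. They
  allow the leading coefficient to vanish, which is the case of a fixed point at \<open>\<infinity>\<close>.
\<close>

lemma f_pair_fixed_points:
  fixes a b c d :: complex
  assumes dist: "distinct [a, b, c, d]"
  obtains N D N' D' k where
    "f a b c d = of_homogeneous N D" "f c d a b = of_homogeneous N' D'"
    "N * D' - N' * D \<noteq> 0"
    "D * D' = k * (a + d - b - c)"
    "N * D' + N' * D = 2 * k * (a * d - b * c)"
    "N * N' = k * (a * d * (b + c) - b * c * (a + d))"
proof -
  define s where "s = csqrt (cross_ratio c a b d)"
  have "cross_ratio a c d b = cross_ratio c a b d"
  proof -
    have "(a - c) * (d - b) = (c - a) * (b - d)" "(c - d) * (b - a) = (a - b) * (d - c)"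
      by algebra+
    then show ?thesis by (simp add: cross_ratio_def)
  qed
  then have s': "csqrt (cross_ratio a c d b) = s"
    by (simp add: s_def)
  have ssq: "s * s * ((a - b) * (d - c)) = (c - a) * (b - d)"
    using dist by (auto simp: s_def cross_ratio_def simp flip: power2_eq_square)
  \<comment> \<open>The one place where the principal branch matters: the root \<open>s = -1\<close> would merge the two points.\<close>
  have "0 \<le> Re s"
    using csqrt_principal[of "cross_ratio c a b d"] by (auto simp: s_def)
  then have "s + 1 \<noteq> 0"
    by (auto simp: complex_eq_iff)
  have "s \<noteq> 0"
    using ssq dist by auto
  define N D N' D' k where "N = c * (b - a) * s + b * (c - a)" and "D = (b - a) * s + (c - a)"
    and "N' = a * (d - c) * s + d * (a - c)" and "D' = (d - c) * s + (a - c)"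
    and "k = (c - a) * (1 + s)"
  note defs = N_def D_def N'_def D'_def k_def
  show ?thesis
  proof
    show "f a b c d = of_homogeneous N D"
      by (simp add: f_def of_homogeneous_def N_def D_def s_def Let_def)
    show "f c d a b = of_homogeneous N' D'"
      by (simp add: f_def of_homogeneous_def N'_def D'_def s' Let_def)
    have "N * D' - N' * D = - 2 * (c - a) * (a - b) * (d - c) * s * (s + 1)"
      using ssq unfolding defs by algebra
    then show "N * D' - N' * D \<noteq> 0"
      using dist \<open>s \<noteq> 0\<close> \<open>s + 1 \<noteq> 0\<close> by auto
    show "D * D' = k * (a + d - b - c)"
      using ssq unfolding defs by algebra
    show "N * D' + N' * D = 2 * k * (a * d - b * c)"
      using ssq unfolding defs by algebra
    show "N * N' = k * (a * d * (b + c) - b * c * (a + d))"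
      using ssq unfolding defs by algebra
  qed
qed

theorem theorem2:
  fixes a b c d :: complex and p_ab p_bc p_cd p_da :: ext_complex
  assumes "distinct [a, b, c, d]"
    and "p_ab = f d a b c"
    and "p_bc = f a b c d"
    and "p_cd = f b c d a"
    and "p_da = f c d a b"
  shows "concyclic {p_ab, p_bc, p_cd, p_da} \<and> ext_cross_ratio p_ab p_bc p_cd p_da = - 1"
proof -
  have "distinct [d, a, b, c]"
    using assms(1) by auto
  from f_pair_fixed_points[OF this] obtain N1 D1 N3 D3 k where
    p13: "p_ab = of_homogeneous N1 D1" "p_cd = of_homogeneous N3 D3" and
    nz13: "N1 * D3 - N3 * D1 \<noteq> 0" and
    q13: "D1 * D3 = k * (d + c - a - b)"
      "N1 * D3 + N3 * D1 = 2 * k * (d * c - a * b)"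
      "N1 * N3 = k * (d * c * (a + b) - a * b * (d + c))"
    unfolding assms(2,4) .
  from f_pair_fixed_points[OF assms(1)] obtain N2 D2 N4 D4 l where
    p24: "p_bc = of_homogeneous N2 D2" "p_da = of_homogeneous N4 D4" and
    nz24: "N2 * D4 - N4 * D2 \<noteq> 0" and
    q24: "D2 * D4 = l * (a + d - b - c)"
      "N2 * D4 + N4 * D2 = 2 * l * (a * d - b * c)"
      "N2 * N4 = l * (a * d * (b + c) - b * c * (a + d))"
    unfolding assms(3,5) .
  \<comment> \<open>The right-hand side is the apolarity pairing of the quadratic forms vanishing at the pairs 1, 3 and 2, 4.\<close>
  have "(N1 * D2 - N2 * D1) * (N3 * D4 - N4 * D3) + (N2 * D3 - N3 * D2) * (N4 * D1 - N1 * D4)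
      = 2 * (N1 * N3) * (D2 * D4) + 2 * (D1 * D3) * (N2 * N4)
        - (N1 * D3 + N3 * D1) * (N2 * D4 + N4 * D2)"
    by algebra
  also have "\<dots> = 0"
    unfolding q13 q24 by algebra
  finally have harmonic: "(N1 * D2 - N2 * D1) * (N3 * D4 - N4 * D3)
      = - ((N2 * D3 - N3 * D2) * (N4 * D1 - N1 * D4))"
    by (simp add: eq_neg_iff_add_eq_0)
  \<comment> \<open>By the Pluecker relation, distinctness inside the two pairs forces distinctness across them.\<close>
  have "2 * ((N1 * D2 - N2 * D1) * (N3 * D4 - N4 * D3))
      = (N1 * D3 - N3 * D1) * (N2 * D4 - N4 * D2)"
    using harmonic by algebra
  then have "(N1 * D2 - N2 * D1) * (N3 * D4 - N4 * D3) \<noteq> 0"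
    using nz13 nz24 by auto
  with harmonic have nz: "N1 * D2 - N2 * D1 \<noteq> 0" "N2 * D3 - N3 * D2 \<noteq> 0"
      "N3 * D4 - N4 * D3 \<noteq> 0" "N4 * D1 - N1 * D4 \<noteq> 0"
    by auto
  have cr: "ext_cross_ratio p_ab p_bc p_cd p_da = - 1"
    unfolding p13 p24 using harmonic nz nz13 nz24 by (rule ext_cross_ratio_harmonic)
  have "distinct [p_ab, p_bc, p_cd, p_da]"
    using of_homogeneous_distinct[OF nz(1)] of_homogeneous_distinct[OF nz(2)] of_homogeneous_distinct[OF nz(3)]
      of_homogeneous_distinct[OF nz(4)] of_homogeneous_distinct[OF nz13] of_homogeneous_distinct[OF nz24]
    by (auto simp: p13 p24)
  with cr show ?thesis
    by (auto intro: concyclic_if_harmonic)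
qed

end
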